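(* Let $(\mathcal P,\sqsubset)$ be a dual CL-shellable pair, let $1\le i\le \mathrm d(\mathcal P)-1$, and let $F\colon \mathcal P^{\mathrm{op}}\to R\text{-mod}$ be a functor which is stable at degree $i$, i.e. for every unrefinable $\hat 1$-chain $c=(c_0\prec c_1\prec\dots\prec c_i=\hat 1)$ of length $i$ the natural map \[ F(c_0)\to \lim_{\langle C(c)\rangle}F \] is an epimorphism. Then \[ H^i(\mathcal P\setminus\{\hat 1\};F)=0 . \]
   Context: $R$ is a commutative ring with unit. For a poset $\mathcal P$, $p\prec q$ means $p<q$ with no element strictly between. An unrefinable $\hat 1$-chain of length $n$ is a sequence $c=(c_0\prec c_1\prec\dots\prec c_n=\hat 1)$ (length $0$: $c=(\hat 1)$). $\mathcal P$ is filtered if $\mathrm d(p)=\max\{n\mid \exists\, c_0\prec\dots\prec c_n=p\}$ is a well-defined natural number for each $p$ and $\mathrm d$ is strictly order preserving; $\mathrm d(\mathcal P)=\max_p \mathrm d(p)$. A bounded poset is a filtered poset with a maximum $\hat 1$ and a minimum $\hat 0$. Write $\mathcal P_{\prec p}=\{q\mid q\prec p\}$, $\mathcal P_{<p}=\{q\mid q<p\}$, and for $Q\subseteq \mathcal P$, $\langle Q\rangle=\{p\in\mathcal P\mid p\le q\text{ for some }q\in Q\}$. A coatom ordering on a bounded poset $\mathcal P$ is a family $\sqsubset=\{\sqsubset_c\}_c$, indexed by all unrefinable $\hat 1$-chains $c$, where $\sqsubset_c$ is a well-order on $\mathcal P_{\prec c_0}$. For $c=(c_0\prec c_1\prec\dots\prec\hat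 1)$ of positive length put $c'=(c_1\prec\dots\prec\hat 1)$ and $C(c)=\{x\prec c_0\mid x<h\text{ for some } h\prec c_1\text{ strictly preceding }c_0\text{ in }\sqsubset_{c'}\}$; put $C(\hat 1)=\emptyset$. The pair $(\mathcal P,\sqsubset)$ is dual CL-shellable (and $\sqsubset$ is a recursive coatom ordering) if for every unrefinable $\hat 1$-chain $c$: (CL0) every initial segment (downward closed subset) of $\sqsubset_c$ is finite or isomorphic to $(\mathbb N,\le)$; (CL1) $C(c)$ is an initial segment of $\sqsubset_c$; (CL2) for $h',h\in\mathcal P_{\prec c_0}$ with $h'$ strictly preceding $h$ in $\sqsubset_c$ and $p\in\mathcal P_{<h}\cap\mathcal P_{<h'}$, there exist $h''\in\mathcal P_{\prec c_0}$ strictly preceding $h$ in $\sqsubset_c$ and $q\in\mathcal P_{\prec h}$ with $p\le q<h''$. For a poset $\mathcal Q$ and $F\colon\mathcal Q^{\mathrm{op}}\to R\text{-mod}$, $H^*(\mathcal Q;F)$ denotes the right derived functors of $\lim\colon \mathrm{Fun}(\mathcal Q^{\mathrm{op}},R\text{-mod})\to R\text{-mod}$ evaluated at $F$ (with $F$ restricted if defined on a larger poset). $\lim_{\mathcal Q}F$ is the limit over $\mathcal Q^{\mathrm{op}}$. *)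

theory Defs
  imports "HOL-Algebra.Module" "HOL-Algebra.AbelCoset"
begin

section \<open>Filtered posets and unrefinable chains\<close>

text \<open>The poset is the whole of a type of class \<^class>\<open>order\<close>. HOL-Algebra has its own
  constant named \<open>top\<close>, so the maximum of the type is written \<open>Orderings.top\<close>.\<close>

definition covered_by :: "'p::order \<Rightarrow> 'p \<Rightarrow> bool"  (infix \<open>\<prec>\<close> 50)
  where "p \<prec> q \<longleftrightarrow> p < q \<and> \<not> (\<exists>r. p < r \<and> r < q)"

definition chain_lengths :: "'p::order \<Rightarrow> nat set"
  where "chain_lengths p =
    {n. \<exists>c. length c = n + 1 \<and> successively (\<prec>) c \<and> last c = p}"

definition deg :: "'p::order \<Rightarrow> nat"
  where "deg p = Max (chain_lengths p)"

text \<open>Every set of chain lengths contains \<open>0\<close>, so its maximum exists iff it is finite.\<close>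

definition filtered :: "'p::order itself \<Rightarrow> bool"
  where "filtered _ \<longleftrightarrow>
    (\<forall>p::'p. finite (chain_lengths p)) \<and> strict_mono (deg :: 'p \<Rightarrow> nat)"

text \<open>For a bounded poset the range below is finite, since \<open>deg\<close> is monotone and there is a
  maximum.\<close>

definition poset_deg :: "'p::order itself \<Rightarrow> nat"
  where "poset_deg _ = Max (range (deg :: 'p \<Rightarrow> nat))"

definition down_closure :: "'p::order set \<Rightarrow> 'p set"
  where "down_closure Q = {p. \<exists>q\<in>Q. p \<le> q}"

text \<open>A chain \<open>c\<^sub>0 \<prec> \<dots> \<prec> c\<^sub>n\<close> is the list \<open>[c\<^sub>0, \<dots>, c\<^sub>n]\<close>; its length in the sense of
  posets is \<open>n\<close>, one less than the length of the list. For positive length, \<open>c'\<close> is \<open>tl c\<close>.\<close>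

definition top_chain :: "'p::order_top list \<Rightarrow> bool"
  where "top_chain c \<longleftrightarrow> c \<noteq> [] \<and> successively (\<prec>) c \<and> last c = Orderings.top"


section \<open>Recursive coatom orderings\<close>

text \<open>\<open>L c\<close> is the (reflexive) well-order indexed by the chain \<open>c\<close>; its values on lists that
  are not chains ending in the maximum are irrelevant.\<close>

definition coatom_ordering :: "('p::order_top list \<Rightarrow> 'p rel) \<Rightarrow> bool"
  where "coatom_ordering L \<longleftrightarrow>
    (\<forall>c. top_chain c \<longrightarrow> well_order_on {q. q \<prec> hd c} (L c))"

definition strictly_precedes :: "'p rel \<Rightarrow> 'p \<Rightarrow> 'p \<Rightarrow> bool"
  where "strictly_precedes r x y \<longleftrightarrow> (x, y) \<in> r \<and> x \<noteq> y"

fun C_set :: "('p::order list \<Rightarrow> 'p rel) \<Rightarrow> 'p list \<Rightarrow> 'p set"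
  where
    "C_set L (c0 # c1 # cs) =
      {x. x \<prec> c0 \<and> (\<exists>h. h \<prec> c1 \<and> strictly_precedes (L (c1 # cs)) h c0 \<and> x < h)}"
  | "C_set L _ = {}"

definition CL0 :: "'p rel \<Rightarrow> bool"
  where "CL0 r \<longleftrightarrow>
    (\<forall>S. Order_Relation.ofilter r S \<longrightarrow> finite S \<or> (Restr r S, natLeq) \<in> ordIso)"

definition CL1 :: "('p::order list \<Rightarrow> 'p rel) \<Rightarrow> 'p list \<Rightarrow> bool"
  where "CL1 L c \<longleftrightarrow> Order_Relation.ofilter (L c) (C_set L c)"

definition CL2 :: "('p::order list \<Rightarrow> 'p rel) \<Rightarrow> 'p list \<Rightarrow> bool"
  where "CL2 L c \<longleftrightarrow>
    (\<forall>h h' p. h \<prec> hd c \<and> h' \<prec> hd c \<and> strictly_precedes (L c) h' h \<and> p < h \<and> p < h' \<longrightarrow>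
      (\<exists>h'' q. h'' \<prec> hd c \<and> strictly_precedes (L c) h'' h \<and> q \<prec> h \<and> p \<le> q \<and> q < h''))"

definition dual_CL_shellable :: "('p::{order_bot,order_top} list \<Rightarrow> 'p rel) \<Rightarrow> bool"
  where "dual_CL_shellable L \<longleftrightarrow>
    filtered TYPE('p) \<and> coatom_ordering L \<and>
    (\<forall>c. top_chain c \<longrightarrow> CL0 (L c) \<and> CL1 L c \<and> CL2 L c)"


section \<open>Modules\<close>

definition module_hom ::
    "('r,'k) ring_scheme \<Rightarrow> ('r,'m) module \<Rightarrow> ('r,'n) module \<Rightarrow> ('m \<Rightarrow> 'n) set"
  where "module_hom R M N =
    {f \<in> hom (add_monoid M) (add_monoid N).
      \<forall>a\<in>carrier R. \<forall>x\<in>carrier M. f (a \<odot>\<^bsub>M\<^esub> x) = a \<odot>\<^bsub>N\<^esub> f x}"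

text \<open>The record of a module extends that of a ring; its multiplicative part plays no role for
  modules and is left undefined below.\<close>

definition quotient_module :: "('r,'m) module \<Rightarrow> 'm set \<Rightarrow> ('r,'m set) module"
  where "quotient_module M N =
    \<lparr>carrier = a_rcosets\<^bsub>M\<^esub> N, mult = undefined, one = undefined,
     zero = N, add = set_add M,
     smult = (\<lambda>a X. N <+>\<^bsub>M\<^esub> ((\<lambda>x. a \<odot>\<^bsub>M\<^esub> x) ` X))\<rparr>"

definition zero_module :: "('r,'m) module \<Rightarrow> bool"
  where "zero_module M \<longleftrightarrow> carrier M = {\<zero>\<^bsub>M\<^esub>}"

text \<open>Cohomology of a cochain complex \<open>M 0 \<rightarrow> M 1 \<rightarrow> \<dots>\<close> with differentials \<open>\<delta> n\<close> from \<open>M n\<close>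
  to \<open>M (Suc n)\<close>.\<close>

definition cocycles :: "(nat \<Rightarrow> ('r,'m) module) \<Rightarrow> (nat \<Rightarrow> 'm \<Rightarrow> 'm) \<Rightarrow> nat \<Rightarrow> 'm set"
  where "cocycles M \<delta> n = a_kernel (M n) (M (Suc n)) (\<delta> n)"

fun coboundaries :: "(nat \<Rightarrow> ('r,'m) module) \<Rightarrow> (nat \<Rightarrow> 'm \<Rightarrow> 'm) \<Rightarrow> nat \<Rightarrow> 'm set"
  where
    "coboundaries M \<delta> 0 = {\<zero>\<^bsub>M 0\<^esub>}"
  | "coboundaries M \<delta> (Suc n) = \<delta> n ` carrier (M n)"

definition cohomology ::
    "(nat \<Rightarrow> ('r,'m) module) \<Rightarrow> (nat \<Rightarrow> 'm \<Rightarrow> 'm) \<Rightarrow> nat \<Rightarrow> ('r,'m set) module"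
  where "cohomology M \<delta> n =
    quotient_module ((M n)\<lparr>carrier := cocycles M \<delta> n\<rparr>) (coboundaries M \<delta> n)"


section \<open>Contravariant functors on a poset with values in modules\<close>

text \<open>\<open>res F q p\<close> is the map \<open>F q \<rightarrow> F p\<close> for \<open>p \<le> q\<close>. All notions below are relative to a
  subset \<open>Q\<close> of the poset, so that restricting a functor to \<open>Q\<close> does not change the record.\<close>

record ('p,'r,'m) presheaf =
  ob :: "'p \<Rightarrow> ('r,'m) module"
  res :: "'p \<Rightarrow> 'p \<Rightarrow> 'm \<Rightarrow> 'm"

definition presheaf_on ::
    "('r,'k) ring_scheme \<Rightarrow> 'p::order set \<Rightarrow> ('p,'r,'m) presheaf \<Rightarrow> bool"
  where "presheaf_on R Q F \<longleftrightarrow>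
    (\<forall>p\<in>Q. module R (ob F p)) \<and>
    (\<forall>p\<in>Q. \<forall>q\<in>Q. p \<le> q \<longrightarrow> res F q p \<in> module_hom R (ob F q) (ob F p)) \<and>
    (\<forall>p\<in>Q. \<forall>x\<in>carrier (ob F p). res F p p x = x) \<and>
    (\<forall>p\<in>Q. \<forall>q\<in>Q. \<forall>r\<in>Q. p \<le> q \<and> q \<le> r \<longrightarrow>
      (\<forall>x\<in>carrier (ob F r). res F q p (res F r q x) = res F r p x))"

definition nat_trans ::
    "('r,'k) ring_scheme \<Rightarrow> 'p::order set \<Rightarrow> ('p,'r,'m) presheaf \<Rightarrow> ('p,'r,'n) presheaf
      \<Rightarrow> ('p \<Rightarrow> 'm \<Rightarrow> 'n) set"
  where "nat_trans R Q F G =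
    {\<eta>. (\<forall>p\<in>Q. \<eta> p \<in> module_hom R (ob F p) (ob G p)) \<and>
      (\<forall>p\<in>Q. \<forall>q\<in>Q. p \<le> q \<longrightarrow>
        (\<forall>x\<in>carrier (ob F q). \<eta> p (res F q p x) = res G q p (\<eta> q x)))}"

definition lim_module :: "'p::order set \<Rightarrow> ('p,'r,'m) presheaf \<Rightarrow> ('r, 'p \<Rightarrow> 'm) module"
  where "lim_module Q F =
    \<lparr>carrier = {s \<in> (\<Pi>\<^sub>E p\<in>Q. carrier (ob F p)).
        \<forall>p\<in>Q. \<forall>q\<in>Q. p \<le> q \<longrightarrow> res F q p (s q) = s p},
     mult = undefined, one = undefined,
     zero = (\<lambda>p\<in>Q. \<zero>\<^bsub>ob F p\<^esub>),
     add = (\<lambda>s t. \<lambda>p\<in>Q. s p \<oplus>\<^bsub>ob F p\<^esub> t p),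
     smult = (\<lambda>a s. \<lambda>p\<in>Q. a \<odot>\<^bsub>ob F p\<^esub> s p)\<rparr>"

definition lim_map :: "'p set \<Rightarrow> ('p \<Rightarrow> 'm \<Rightarrow> 'n) \<Rightarrow> ('p \<Rightarrow> 'm) \<Rightarrow> ('p \<Rightarrow> 'n)"
  where "lim_map Q \<eta> s = (\<lambda>p\<in>Q. \<eta> p (s p))"

text \<open>The natural map from \<open>F q\<close> to the limit over a set \<open>Q\<close> of elements below \<open>q\<close>.\<close>

definition to_lim :: "'p set \<Rightarrow> ('p,'r,'m) presheaf \<Rightarrow> 'p \<Rightarrow> 'm \<Rightarrow> ('p \<Rightarrow> 'm)"
  where "to_lim Q F q x = (\<lambda>p\<in>Q. res F q p x)"

definition stable_at ::
    "('p::order_top list \<Rightarrow> 'p rel) \<Rightarrow> ('p,'r,'m) presheaf \<Rightarrow> nat \<Rightarrow> bool"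
  where "stable_at L F i \<longleftrightarrow>
    (\<forall>c. top_chain c \<and> length c = i + 1 \<longrightarrow>
      to_lim (down_closure (C_set L c)) F (hd c) ` carrier (ob F (hd c)) =
        carrier (lim_module (down_closure (C_set L c)) F))"


section \<open>Right derived functors of the limit\<close>

text \<open>HOL cannot quantify over all functors with values in modules of arbitrary carrier type
  inside a formula, so the type \<open>'v\<close> of the carriers of the test objects is a parameter. By
  Baer's criterion (a functor is injective iff maps extend from subfunctors of the functors
  \<open>p \<mapsto> R\<close> for \<open>p \<le> q\<close>, \<open>0\<close> otherwise), the notion does not depend on \<open>'v\<close> as soon as
  \<open>carrier R\<close> embeds into \<open>'v\<close>. Monomorphisms of functors are the objectwise injective
  transformations.\<close>

definition injective_presheaf ::
    "'v itself \<Rightarrow> ('r,'k) ring_scheme \<Rightarrow> 'p::order set \<Rightarrow> ('p,'r,'m) presheaf \<Rightarrow> bool"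
  where "injective_presheaf _ R Q I \<longleftrightarrow>
    presheaf_on R Q I \<and>
    (\<forall>(A::('p,'r,'v) presheaf) (B::('p,'r,'v) presheaf).
      presheaf_on R Q A \<and> presheaf_on R Q B \<longrightarrow>
      (\<forall>\<alpha>\<in>nat_trans R Q A B. \<forall>\<phi>\<in>nat_trans R Q A I.
        (\<forall>p\<in>Q. inj_on (\<alpha> p) (carrier (ob A p))) \<longrightarrow>
        (\<exists>\<psi>\<in>nat_trans R Q B I. \<forall>p\<in>Q. \<forall>x\<in>carrier (ob A p). \<psi> p (\<alpha> p x) = \<phi> p x)))"

text \<open>Exact sequence \<open>0 \<rightarrow> F \<rightarrow> I 0 \<rightarrow> I 1 \<rightarrow> \<dots>\<close> of functors on \<open>Q\<close>, with augmentation \<open>\<epsilon>\<close>,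
  differentials \<open>d n\<close> and all \<open>I n\<close> injective. Exactness is objectwise. The test objects have
  carriers in \<open>'r + 'u\<close>, which contains copies of \<open>R\<close> and of the values of the \<open>I n\<close>.\<close>

definition injective_resolution ::
    "('r,'k) ring_scheme \<Rightarrow> 'p::order set \<Rightarrow> ('p,'r,'m) presheaf \<Rightarrow> ('p \<Rightarrow> 'm \<Rightarrow> 'u)
      \<Rightarrow> (nat \<Rightarrow> ('p,'r,'u) presheaf) \<Rightarrow> (nat \<Rightarrow> 'p \<Rightarrow> 'u \<Rightarrow> 'u) \<Rightarrow> bool"
  where "injective_resolution R Q F \<epsilon> I d \<longleftrightarrow>
    (\<forall>n. injective_presheaf TYPE('r + 'u) R Q (I n)) \<and>
    \<epsilon> \<in> nat_trans R Q F (I 0) \<and>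
    (\<forall>n. d n \<in> nat_trans R Q (I n) (I (Suc n))) \<and>
    (\<forall>p\<in>Q.
      inj_on (\<epsilon> p) (carrier (ob F p)) \<and>
      \<epsilon> p ` carrier (ob F p) = a_kernel (ob (I 0) p) (ob (I (Suc 0)) p) (d 0 p) \<and>
      (\<forall>n. d n p ` carrier (ob (I n) p) =
        a_kernel (ob (I (Suc n)) p) (ob (I (Suc (Suc n))) p) (d (Suc n) p)))"

text \<open>The value of the \<open>n\<close>-th right derived functor of the limit over \<open>Q\<close>, computed from an
  injective resolution; it depends on the resolution only up to isomorphism.\<close>

definition higher_limit ::
    "'p::order set \<Rightarrow> (nat \<Rightarrow> ('p,'r,'u) presheaf) \<Rightarrow> (nat \<Rightarrow> 'p \<Rightarrow> 'u \<Rightarrow> 'u) \<Rightarrow> nat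
      \<Rightarrow> ('r, ('p \<Rightarrow> 'u) set) module"
  where "higher_limit Q I d n =
    cohomology (\<lambda>k. lim_module Q (I k)) (\<lambda>k. lim_map Q (d k)) n"

end

theory Submission
  imports Defs
begin

text \<open>Injective functors are flasque: sections over a down-closed subset extend, because the
  functor equal to \<open>R\<close> on a down-closed subset and zero outside represents the sections over it.
  So cohomology over down-closed subsets can be computed with global sections of one resolution.
  For an initial segment \<open>S\<close> of the coatoms \<open>h\<close> below the head of a chain \<open>c\<close> of length \<open>i - k\<close>
  one shows by induction on \<open>k \<ge> 1\<close> that \<open>H\<^sup>k\<close> of \<open>\<langle>S\<rangle>\<close> vanishes. A primitive of a cocycle is
  constructed by transfinite recursion along \<open>S\<close>, without changing it on the ideals already
  treated. By (CL2) the principal ideal \<open>\<langle>h\<rangle>\<close> meets the preceding ones in \<open>\<langle>C(h # c)\<rangle>\<close>, so a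
  primitive extends over \<open>\<langle>h\<rangle>\<close> once \<open>H\<^sup>k\<close> of the pair \<open>(\<langle>h\<rangle>, \<langle>C(h # c)\<rangle>)\<close> vanishes, that is,
  once restriction from \<open>\<langle>h\<rangle>\<close> to \<open>\<langle>C(h # c)\<rangle>\<close> is surjective on cohomology in degree \<open>k - 1\<close>:
  this is stability for \<open>k = 1\<close>, and by (CL1) it is the induction hypothesis for \<open>k > 1\<close>.\<close>

section \<open>Sections over down-closed subsets\<close>

lemma mem_a_kernel:
  "x \<in> a_kernel M N f \<longleftrightarrow> x \<in> carrier M \<and> f x = \<zero>\<^bsub>N\<^esub>"
  by (simp add: a_kernel_def')

lemma module_hom_closed:
  assumes "f \<in> module_hom R M N" "x \<in> carrier M"
  shows "f x \<in> carrier N"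
  using assms by (auto simp: module_hom_def hom_def)

lemma module_hom_abelian_group_hom:
  assumes "f \<in> module_hom R M N" "module R M" "module R N"
  shows "abelian_group_hom M N f"
proof -
  interpret M: module R M by fact
  interpret N: module R N by fact
  show ?thesis
    using assms(1)
    by (intro abelian_group_homI M.abelian_group_axioms N.abelian_group_axioms group_hom.intro
          M.a_group N.a_group group_hom_axioms.intro)
      (simp add: module_hom_def)
qed

lemma module_hom_add:
  assumes "f \<in> module_hom R M N" "module R M" "module R N" "x \<in> carrier M" "y \<in> carrier M"
  shows "f (x \<oplus>\<^bsub>M\<^esub> y) = f x \<oplus>\<^bsub>N\<^esub> f y"
  using abelian_group_hom.hom_add[OF module_hom_abelian_group_hom[OF assms(1-3)]] assms(4,5)
  by simp

lemma module_hom_zero: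
  assumes "f \<in> module_hom R M N" "module R M" "module R N"
  shows "f \<zero>\<^bsub>M\<^esub> = \<zero>\<^bsub>N\<^esub>"
  using abelian_group_hom.hom_zero[OF module_hom_abelian_group_hom[OF assms]] by simp

lemma module_hom_minus:
  assumes "f \<in> module_hom R M N" "module R M" "module R N" "x \<in> carrier M" "y \<in> carrier M"
  shows "f (x \<ominus>\<^bsub>M\<^esub> y) = f x \<ominus>\<^bsub>N\<^esub> f y"
proof -
  interpret abelian_group_hom M N f by (rule module_hom_abelian_group_hom[OF assms(1-3)])
  show ?thesis using assms(4,5) by (simp add: a_minus_def)
qed

lemma mem_lim_module:
  "s \<in> carrier (lim_module A G) \<longleftrightarrow>
    s \<in> extensional A \<and> (\<forall>p\<in>A. s p \<in> carrier (ob G p)) \<and>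
    (\<forall>p\<in>A. \<forall>q\<in>A. p \<le> q \<longrightarrow> res G q p (s q) = s p)"
  by (auto simp: lim_module_def PiE_iff)

lemma lim_module_add_closed:
  assumes "presheaf_on R A G" "s \<in> carrier (lim_module A G)" "t \<in> carrier (lim_module A G)"
  shows "(\<lambda>p\<in>A. s p \<oplus>\<^bsub>ob G p\<^esub> t p) \<in> carrier (lim_module A G)"
proof -
  have "s p \<oplus>\<^bsub>ob G p\<^esub> t p \<in> carrier (ob G p)" if "p \<in> A" for p
  proof -
    interpret module R "ob G p" using assms(1) that by (simp add: presheaf_on_def)
    show ?thesis using assms(2,3) that by (simp add: mem_lim_module)
  qed
  moreover have "res G q p (s q \<oplus>\<^bsub>ob G q\<^esub> t q) = s p \<oplus>\<^bsub>ob G p\<^esub> t p"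
    if "p \<in> A" "q \<in> A" "p \<le> q" for p q
    using assms that module_hom_add[of "res G q p" R "ob G q" "ob G p" "s q" "t q"]
    by (simp add: presheaf_on_def mem_lim_module)
  ultimately show ?thesis by (simp add: mem_lim_module)
qed

lemma lim_module_minus_closed:
  assumes "presheaf_on R A G" "s \<in> carrier (lim_module A G)" "t \<in> carrier (lim_module A G)"
  shows "(\<lambda>p\<in>A. s p \<ominus>\<^bsub>ob G p\<^esub> t p) \<in> carrier (lim_module A G)"
proof -
  have "s p \<ominus>\<^bsub>ob G p\<^esub> t p \<in> carrier (ob G p)" if "p \<in> A" for p
  proof -
    interpret module R "ob G p" using assms(1) that by (simp add: presheaf_on_def)
    show ?thesis using assms(2,3) that by (simp add: mem_lim_module)
  qed
  moreover have "res G q p (s q \<ominus>\<^bsub>ob G q\<^esub> t q) = s p \<ominus>\<^bsub>ob G p\<^esub> t p"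
    if "p \<in> A" "q \<in> A" "p \<le> q" for p q
    using assms that module_hom_minus[of "res G q p" R "ob G q" "ob G p" "s q" "t q"]
    by (simp add: presheaf_on_def mem_lim_module)
  ultimately show ?thesis by (simp add: mem_lim_module)
qed

lemma lim_map_closed:
  assumes "\<eta> \<in> nat_trans R A G H" "s \<in> carrier (lim_module A G)"
  shows "lim_map A \<eta> s \<in> carrier (lim_module A H)"
  unfolding mem_lim_module
proof (intro conjI ballI impI)
  show "lim_map A \<eta> s \<in> extensional A" by (simp add: lim_map_def)
  fix p assume "p \<in> A"
  then show "lim_map A \<eta> s p \<in> carrier (ob H p)"
    using assms by (auto simp: lim_map_def nat_trans_def mem_lim_module intro: module_hom_closed)
next
  fix p q assume pq: "p \<in> A" "q \<in> A" "p \<le> q"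
  have "\<eta> p (res G q p (s q)) = res H q p (\<eta> q (s q))"
    using assms pq unfolding nat_trans_def mem_lim_module by blast
  moreover have "res G q p (s q) = s p"
    using assms(2) pq by (simp add: mem_lim_module)
  ultimately show "res H q p (lim_map A \<eta> s q) = lim_map A \<eta> s p"
    using pq by (simp add: lim_map_def)
qed

section \<open>Flasqueness of injective functors\<close>

definition down_closed_in :: "'p::order set \<Rightarrow> 'p set \<Rightarrow> bool"
  where "down_closed_in Q A \<longleftrightarrow> A \<subseteq> Q \<and> (\<forall>p\<in>A. \<forall>q\<in>Q. q \<le> p \<longrightarrow> q \<in> A)"

text \<open>The functor equal to \<open>R\<close> on \<open>A\<close> and zero elsewhere, with carriers in the type of the test
  objects of \<open>injective_resolution\<close>. The restriction maps out of the zero values are identities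
  as well, as these values are \<open>{Inl \<zero>}\<close>.\<close>

definition const_presheaf ::
    "('r,'k) ring_scheme \<Rightarrow> 'p set \<Rightarrow> ('p, 'r, 'r + 'u) presheaf"
  where "const_presheaf R A =
    \<lparr>ob = (\<lambda>p. \<lparr>carrier = (if p \<in> A then Inl ` carrier R else {Inl \<zero>\<^bsub>R\<^esub>}),
        mult = undefined, one = undefined, zero = Inl \<zero>\<^bsub>R\<^esub>,
        add = (\<lambda>x y. Inl (projl x \<oplus>\<^bsub>R\<^esub> projl y)),
        smult = (\<lambda>a x. Inl (a \<otimes>\<^bsub>R\<^esub> projl x))\<rparr>),
     res = (\<lambda>q p x. x)\<rparr>"

lemma const_presheaf_module:
  assumes "cring R"
  shows "module R (ob (const_presheaf R A) p)"
proof -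
  interpret cring R by fact
  show ?thesis
  proof (intro moduleI abelian_groupI)
    show "cring R" by fact
    fix x assume "x \<in> carrier (ob (const_presheaf R A) p)"
    then show "\<exists>y\<in>carrier (ob (const_presheaf R A) p).
        y \<oplus>\<^bsub>ob (const_presheaf R A) p\<^esub> x = \<zero>\<^bsub>ob (const_presheaf R A) p\<^esub>"
      by (auto simp: const_presheaf_def l_neg intro!: bexI[of _ "Inl (\<ominus>\<^bsub>R\<^esub> projl x)"]
          split: if_splits)
  qed (auto simp: const_presheaf_def a_ac m_assoc l_distr r_distr split: if_splits)
qed

text \<open>The identity maps the value at \<open>q\<close> into the value at
  \<open>p \<le> q\<close>: if \<open>q \<in> A\<close>, then \<open>p \<in> A\<close> by
  down-closedness, and otherwise the value at \<open>q\<close> is zero.\<close>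

lemma const_presheaf_presheaf_on:
  fixes A :: "'p::order set"
  assumes "cring R" "down_closed_in Q A"
  shows "presheaf_on R Q (const_presheaf R A :: ('p, 'r, 'r + 'u) presheaf)"
proof -
  interpret cring R by fact
  let ?A = "const_presheaf R A :: ('p, 'r, 'r + 'u) presheaf"
  have "res ?A q p \<in> module_hom R (ob ?A q) (ob ?A p)"
    if "p \<in> Q" "q \<in> Q" "p \<le> q" for p q
    using that assms(2)
    by (auto simp: module_hom_def hom_def const_presheaf_def down_closed_in_def)
  moreover have "res ?A q p x = x" for p q x
    by (simp add: const_presheaf_def)
  ultimately show ?thesis
    by (simp add: presheaf_on_def const_presheaf_module[OF assms(1)])
qed

text \<open>A compatible family on \<open>A\<close> amounts to a transformation from
  \<open>const_presheaf R A\<close> to \<open>G\<close>, through the value at the unit. Injectivity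
  extends it along the inclusion into \<open>const_presheaf R Q\<close>, whose transformations to
  \<open>G\<close> are global sections.\<close>

lemma injective_presheaf_flasque:
  fixes G :: "('p::order, 'r, 'u) presheaf"
  assumes "cring R" and inj: "injective_presheaf TYPE('r + 'u) R Q G"
    and A: "down_closed_in Q A"
    and s: "\<And>p. p \<in> A \<Longrightarrow> s p \<in> carrier (ob G p)"
      "\<And>p q. p \<in> A \<Longrightarrow> q \<in> A \<Longrightarrow> p \<le> q \<Longrightarrow> res G q p (s q) = s p"
  shows "\<exists>t\<in>carrier (lim_module Q G). \<forall>p\<in>A. t p = s p"
proof -
  interpret cring R by fact
  let ?A = "const_presheaf R A :: ('p, 'r, 'r + 'u) presheaf"
  let ?Q = "const_presheaf R Q :: ('p, 'r, 'r + 'u) presheaf"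
  have G: "presheaf_on R Q G" using inj by (simp add: injective_presheaf_def)
  have Q: "down_closed_in Q Q" by (simp add: down_closed_in_def)
  have AQ: "A \<subseteq> Q" using A by (simp add: down_closed_in_def)
  define \<alpha> where "\<alpha> = (\<lambda>(p::'p) (x::'r + 'u). x)"
  define \<phi> where "\<phi> = (\<lambda>p (x::'r + 'u). if p \<in> A then projl x \<odot>\<^bsub>ob G p\<^esub> s p else \<zero>\<^bsub>ob G p\<^esub>)"
  have \<alpha>: "\<alpha> \<in> nat_trans R Q ?A ?Q"
    using AQ by (auto simp: nat_trans_def \<alpha>_def module_hom_def hom_def const_presheaf_def)
  have \<phi>_hom: "\<phi> p \<in> module_hom R (ob ?A p) (ob G p)" if "p \<in> Q" for p
  proof -
    interpret M: module R "ob G p" using G that by (simp add: presheaf_on_def)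
    show ?thesis
      using s(1)[of p]
      by (auto simp: \<phi>_def module_hom_def hom_def const_presheaf_def M.smult_l_distr
          M.smult_assoc1 Pi_def)
  qed
  have \<phi>_nat: "\<phi> p (res ?A q p x) = res G q p (\<phi> q x)"
    if "p \<in> Q" "q \<in> Q" "p \<le> q" "x \<in> carrier (ob ?A q)" for p q x
  proof -
    interpret M: module R "ob G p" using G that by (simp add: presheaf_on_def)
    interpret N: module R "ob G q" using G that by (simp add: presheaf_on_def)
    have hom: "res G q p \<in> module_hom R (ob G q) (ob G p)"
      using G that by (simp add: presheaf_on_def)
    show ?thesis
    proof (cases "q \<in> A")
      case True
      then have "p \<in> A" using A that by (auto simp: down_closed_in_def)
      moreover have "projl x \<in> carrier R" using that True by (auto simp: const_presheaf_def)
      ultimately show ?thesis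
        using True s hom that by (simp add: \<phi>_def const_presheaf_def module_hom_def)
    next
      case False
      \<comment> \<open>Here \<open>p\<close> may still lie in \<open>A\<close>; both sides vanish
        because \<open>x\<close> is zero and zero acts as zero on \<open>s p\<close>.\<close>
      then have "x = Inl \<zero>\<^bsub>R\<^esub>" using that by (auto simp: const_presheaf_def)
      then show ?thesis
        using False module_hom_zero[OF hom N.module_axioms M.module_axioms] s(1)[of p]
        by (simp add: \<phi>_def const_presheaf_def)
    qed
  qed
  have "\<phi> \<in> nat_trans R Q ?A G"
    using \<phi>_hom \<phi>_nat by (simp add: nat_trans_def)
  moreover have "\<forall>p\<in>Q. inj_on (\<alpha> p) (carrier (ob ?A p))"
    by (simp add: \<alpha>_def)
  ultimately obtain \<psi> where \<psi>: "\<psi> \<in> nat_trans R Q ?Q G"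
    and \<psi>\<phi>: "\<And>p x. p \<in> Q \<Longrightarrow> x \<in> carrier (ob ?A p) \<Longrightarrow> \<psi> p (\<alpha> p x) = \<phi> p x"
    using inj \<alpha> const_presheaf_presheaf_on[OF assms(1) A] const_presheaf_presheaf_on[OF assms(1) Q]
    unfolding injective_presheaf_def by blast
  \<comment> \<open>The global section is read off at the unit, which every restriction map of
    \<open>?Q\<close> fixes.\<close>
  define t where "t = (\<lambda>p\<in>Q. \<psi> p (Inl \<one>\<^bsub>R\<^esub>))"
  have one: "Inl \<one>\<^bsub>R\<^esub> \<in> carrier (ob ?Q p)" if "p \<in> Q" for p
    using that by (simp add: const_presheaf_def)
  have "\<psi> p (Inl \<one>\<^bsub>R\<^esub>) \<in> carrier (ob G p)" if "p \<in> Q" for p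
    using \<psi> one that by (auto simp: nat_trans_def intro: module_hom_closed)
  moreover have "res G q p (\<psi> q (Inl \<one>\<^bsub>R\<^esub>)) = \<psi> p (Inl \<one>\<^bsub>R\<^esub>)"
    if "p \<in> Q" "q \<in> Q" "p \<le> q" for p q
  proof -
    have "\<psi> p (res ?Q q p (Inl \<one>\<^bsub>R\<^esub>)) = res G q p (\<psi> q (Inl \<one>\<^bsub>R\<^esub>))"
      using \<psi> one that by (simp add: nat_trans_def)
    then show ?thesis by (simp add: const_presheaf_def)
  qed
  ultimately have "t \<in> carrier (lim_module Q G)"
    by (simp add: mem_lim_module t_def)
  moreover have "t p = s p" if "p \<in> A" for p
  proof -
    interpret M: module R "ob G p" using G that AQ by (auto simp: presheaf_on_def)
    have "Inl \<one>\<^bsub>R\<^esub> \<in> carrier (ob ?A p)" using that by (simp add: const_presheaf_def)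
    then show ?thesis
      using \<psi>\<phi>[of p "Inl \<one>\<^bsub>R\<^esub>"] that AQ s(1) by (auto simp: t_def \<alpha>_def \<phi>_def)
  qed
  ultimately show ?thesis by blast
qed

section \<open>Primitives of sections of an injective resolution\<close>

locale presheaf_resolution =
  fixes R :: "('r,'k) ring_scheme"
    and Q :: "'p::order set"
    and F :: "('p,'r,'m) presheaf"
    and \<epsilon> :: "'p \<Rightarrow> 'm \<Rightarrow> 'u"
    and I :: "nat \<Rightarrow> ('p,'r,'u) presheaf"
    and d :: "nat \<Rightarrow> 'p \<Rightarrow> 'u \<Rightarrow> 'u"
  assumes cring: "cring R"
    and F_presheaf: "presheaf_on R Q F"
    and resolution: "injective_resolution R Q F \<epsilon> I d"
begin

section \<open>Objectwise form of the resolution\<close>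

lemma I_injective: "injective_presheaf TYPE('r + 'u) R Q (I k)"
  using resolution by (simp add: injective_resolution_def)

lemma I_presheaf: "presheaf_on R Q (I k)"
  using I_injective by (simp add: injective_presheaf_def)

lemma I_module: "p \<in> Q \<Longrightarrow> module R (ob (I k) p)"
  using I_presheaf by (simp add: presheaf_on_def)

lemma res_I_closed:
  "\<lbrakk>p \<in> Q; q \<in> Q; p \<le> q; x \<in> carrier (ob (I k) q)\<rbrakk> \<Longrightarrow> res (I k) q p x \<in> carrier (ob (I k) p)"
  by (rule module_hom_closed[of _ R "ob (I k) q"]) (use I_presheaf[of k] in \<open>simp_all add: presheaf_on_def\<close>)

lemma res_I_res:
  "\<lbrakk>p \<in> Q; q \<in> Q; r \<in> Q; p \<le> q; q \<le> r; x \<in> carrier (ob (I k) r)\<rbrakk>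
    \<Longrightarrow> res (I k) q p (res (I k) r q x) = res (I k) r p x"
  using I_presheaf[of k] unfolding presheaf_on_def by blast

lemma res_F_closed:
  "\<lbrakk>p \<in> Q; q \<in> Q; p \<le> q; x \<in> carrier (ob F q)\<rbrakk> \<Longrightarrow> res F q p x \<in> carrier (ob F p)"
  by (rule module_hom_closed[of _ R "ob F q"]) (use F_presheaf in \<open>simp_all add: presheaf_on_def\<close>)

lemma d_nat: "d k \<in> nat_trans R Q (I k) (I (Suc k))"
  using resolution by (simp add: injective_resolution_def)

lemma d_hom: "p \<in> Q \<Longrightarrow> d k p \<in> module_hom R (ob (I k) p) (ob (I (Suc k)) p)"
  using d_nat by (simp add: nat_trans_def)

lemma d_closed: "\<lbrakk>p \<in> Q; x \<in> carrier (ob (I k) p)\<rbrakk> \<Longrightarrow> d k p x \<in> carrier (ob (I (Suc k)) p)"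
  by (rule module_hom_closed[OF d_hom])

lemma d_add:
  "\<lbrakk>p \<in> Q; x \<in> carrier (ob (I k) p); y \<in> carrier (ob (I k) p)\<rbrakk>
    \<Longrightarrow> d k p (x \<oplus>\<^bsub>ob (I k) p\<^esub> y) = d k p x \<oplus>\<^bsub>ob (I (Suc k)) p\<^esub> d k p y"
  by (rule module_hom_add[OF d_hom I_module I_module])

lemma d_minus:
  "\<lbrakk>p \<in> Q; x \<in> carrier (ob (I k) p); y \<in> carrier (ob (I k) p)\<rbrakk>
    \<Longrightarrow> d k p (x \<ominus>\<^bsub>ob (I k) p\<^esub> y) = d k p x \<ominus>\<^bsub>ob (I (Suc k)) p\<^esub> d k p y"
  by (rule module_hom_minus[OF d_hom I_module I_module])

lemma d_res:
  "\<lbrakk>p \<in> Q; q \<in> Q; p \<le> q; x \<in> carrier (ob (I k) q)\<rbrakk>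
    \<Longrightarrow> d k p (res (I k) q p x) = res (I (Suc k)) q p (d k q x)"
  using d_nat[of k] unfolding nat_trans_def by blast

lemma d_exact:
  assumes "p \<in> Q"
  shows "d k p ` carrier (ob (I k) p) =
    {x \<in> carrier (ob (I (Suc k)) p). d (Suc k) p x = \<zero>\<^bsub>ob (I (Suc (Suc k))) p\<^esub>}"
  using resolution assms unfolding injective_resolution_def a_kernel_def' by blast

lemma d_d:
  "\<lbrakk>p \<in> Q; x \<in> carrier (ob (I k) p)\<rbrakk> \<Longrightarrow> d (Suc k) p (d k p x) = \<zero>\<^bsub>ob (I (Suc (Suc k))) p\<^esub>"
  using d_exact[of p k] by blast

lemma \<epsilon>_exact:
  assumes "p \<in> Q"
  shows "\<epsilon> p ` carrier (ob F p) =
    {x \<in> carrier (ob (I 0) p). d 0 p x = \<zero>\<^bsub>ob (I (Suc 0)) p\<^esub>}"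
  using resolution assms unfolding injective_resolution_def a_kernel_def' by blast

lemma \<epsilon>_inj: "p \<in> Q \<Longrightarrow> inj_on (\<epsilon> p) (carrier (ob F p))"
  using resolution unfolding injective_resolution_def by blast

lemma \<epsilon>_closed: "\<lbrakk>p \<in> Q; x \<in> carrier (ob F p)\<rbrakk> \<Longrightarrow> \<epsilon> p x \<in> carrier (ob (I 0) p)"
  using \<epsilon>_exact by blast

lemma d_\<epsilon>: "\<lbrakk>p \<in> Q; x \<in> carrier (ob F p)\<rbrakk> \<Longrightarrow> d 0 p (\<epsilon> p x) = \<zero>\<^bsub>ob (I (Suc 0)) p\<^esub>"
  using \<epsilon>_exact by blast

lemma \<epsilon>_res:
  "\<lbrakk>p \<in> Q; q \<in> Q; p \<le> q; x \<in> carrier (ob F q)\<rbrakk>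
    \<Longrightarrow> \<epsilon> p (res F q p x) = res (I 0) q p (\<epsilon> q x)"
  using resolution unfolding injective_resolution_def nat_trans_def by blast

section \<open>Global sections and gluing\<close>

abbreviation sections :: "nat \<Rightarrow> ('p \<Rightarrow> 'u) set"
  where "sections k \<equiv> carrier (lim_module Q (I k))"

lemma sections_closed: "\<lbrakk>s \<in> sections k; p \<in> Q\<rbrakk> \<Longrightarrow> s p \<in> carrier (ob (I k) p)"
  by (simp add: mem_lim_module)

lemma sections_res: "\<lbrakk>s \<in> sections k; p \<in> Q; q \<in> Q; p \<le> q\<rbrakk> \<Longrightarrow> res (I k) q p (s q) = s p"
  by (simp add: mem_lim_module)

text \<open>A section over a down-closed set is thereby represented by any global section with the
  same values there, so later statements about a subset only constrain the values on it.\<close>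

lemma extend_section:
  assumes "down_closed_in Q A"
    and "\<And>p. p \<in> A \<Longrightarrow> s p \<in> carrier (ob (I k) p)"
    and "\<And>p q. p \<in> A \<Longrightarrow> q \<in> A \<Longrightarrow> p \<le> q \<Longrightarrow> res (I k) q p (s q) = s p"
  shows "\<exists>t\<in>sections k. \<forall>p\<in>A. t p = s p"
  by (rule injective_presheaf_flasque[OF cring I_injective assms])

text \<open>Agreement on overlaps makes the value at \<open>p\<close> independent of the principal
  ideal chosen to contain it. Compatibility can be checked inside one ideal, since any ideal
  containing \<open>q\<close> contains everything below \<open>q\<close>. The union of the ideals is
  down-closed, so the family extends to \<open>Q\<close>.\<close>

lemma glue_sections:
  assumes f: "\<And>g. g \<in> T \<Longrightarrow> f g \<in> sections k"
    and agree: "\<And>g h p. \<lbrakk>g \<in> T; h \<in> T; p \<in> Q; p \<le> g; p \<le> h\<rbrakk> \<Longrightarrow> f g p = f h p"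
  shows "\<exists>t\<in>sections k. \<forall>g\<in>T. \<forall>p\<in>Q. p \<le> g \<longrightarrow> t p = f g p"
proof -
  let ?A = "{p \<in> Q. \<exists>g\<in>T. p \<le> g}"
  define s where "s p = f (SOME g. g \<in> T \<and> p \<le> g) p" for p
  have s: "s p = f g p" if "g \<in> T" "p \<in> Q" "p \<le> g" for g p
  proof -
    have "(SOME g. g \<in> T \<and> p \<le> g) \<in> T \<and> p \<le> (SOME g. g \<in> T \<and> p \<le> g)"
      by (rule someI[of _ g]) (use that in simp)
    then show ?thesis unfolding s_def by (intro agree) (use that in simp_all)
  qed
  have A: "down_closed_in Q ?A"
    by (auto simp: down_closed_in_def intro: order_trans)
  have closed: "s p \<in> carrier (ob (I k) p)" if p: "p \<in> ?A" for p
  proof -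
    obtain g where g: "g \<in> T" "p \<le> g" using p by blast
    then have "s p = f g p" using p by (simp add: s)
    then show ?thesis using f g p by (simp add: sections_closed)
  qed
  have compat: "res (I k) q p (s q) = s p" if pq: "p \<in> ?A" "q \<in> ?A" "p \<le> q" for p q
  proof -
    obtain g where g: "g \<in> T" "q \<le> g" using pq by blast
    then have "s q = f g q" "s p = f g p"
      using pq by (auto intro!: s intro: order_trans)
    then show ?thesis using f g pq by (simp add: sections_res)
  qed
  obtain t where t: "t \<in> sections k" "\<And>p. p \<in> ?A \<Longrightarrow> t p = s p"
    using extend_section[OF A closed compat] by blast
  show ?thesis
  proof (intro bexI[OF _ t(1)] ballI impI)
    fix g p assume g: "g \<in> T" "p \<in> Q" "p \<le> g"
    then have "p \<in> ?A" by blast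
    then show "t p = f g p" using t(2)[of p] s[OF g] by simp
  qed
qed

section \<open>Extension of cocycles and construction of primitives\<close>

text \<open>Vanishing of the cohomology of \<open>B\<close> in degree \<open>Suc k\<close>.\<close>

definition exact_on :: "nat \<Rightarrow> 'p set \<Rightarrow> bool"
  where "exact_on k B \<longleftrightarrow>
    (\<forall>s\<in>sections (Suc k). (\<forall>p\<in>B. d (Suc k) p (s p) = \<zero>\<^bsub>ob (I (Suc (Suc k))) p\<^esub>) \<longrightarrow>
      (\<exists>t\<in>sections k. \<forall>p\<in>B. d k p (t p) = s p))"

text \<open>Sufficient for \<open>H\<^sup>k\<close> of the principal ideal of \<open>h\<close> to map onto \<open>H\<^sup>k\<close> of \<open>C\<close>.\<close>

definition restriction_onto :: "nat \<Rightarrow> 'p \<Rightarrow> 'p set \<Rightarrow> bool"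
  where "restriction_onto k h C \<longleftrightarrow>
    (case k of
      0 \<Rightarrow> to_lim C F h ` carrier (ob F h) = carrier (lim_module C F)
    | Suc j \<Rightarrow> exact_on j C)"

lemma down_closed_in_principal: "down_closed_in Q {p \<in> Q. p \<le> h}"
  by (auto simp: down_closed_in_def intro: order_trans)

text \<open>For \<open>k = Suc j\<close> the cocycle has a primitive \<open>v\<close> on
  \<open>C\<close>; as \<open>v\<close> is a global section, its differential is a cocycle
  everywhere and extends \<open>u\<close>. For \<open>k = 0\<close> the cocycle comes from a section
  of \<open>F\<close> over \<open>C\<close>, which lifts to an element of \<open>F\<close> at
  \<open>h\<close>.\<close>

lemma cocycle_extends:
  assumes h: "h \<in> Q" and C: "C \<subseteq> {p \<in> Q. p \<le> h}"
    and onto: "restriction_onto k h C"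
    and u: "u \<in> sections k" "\<And>p. p \<in> C \<Longrightarrow> d k p (u p) = \<zero>\<^bsub>ob (I (Suc k)) p\<^esub>"
  obtains w where "w \<in> sections k" "\<And>p. p \<in> C \<Longrightarrow> w p = u p"
    "\<And>p. \<lbrakk>p \<in> Q; p \<le> h\<rbrakk> \<Longrightarrow> d k p (w p) = \<zero>\<^bsub>ob (I (Suc k)) p\<^esub>"
proof (cases k)
  case (Suc j)
  then have "exact_on j C" using onto by (simp add: restriction_onto_def)
  moreover have "\<forall>p\<in>C. d (Suc j) p (u p) = \<zero>\<^bsub>ob (I (Suc (Suc j))) p\<^esub>"
    using u(2) Suc by simp
  ultimately obtain v where v: "v \<in> sections j" "\<And>p. p \<in> C \<Longrightarrow> d j p (v p) = u p"
    using u(1) Suc unfolding exact_on_def by blast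
  show thesis
  proof (rule that)
    show "lim_map Q (d j) v \<in> sections k"
      using lim_map_closed[OF d_nat v(1)] Suc by simp
    show "lim_map Q (d j) v p = u p" if "p \<in> C" for p
      using that C v(2) by (auto simp: lim_map_def)
    show "d k p (lim_map Q (d j) v p) = \<zero>\<^bsub>ob (I (Suc k)) p\<^esub>" if "p \<in> Q" for p
      using that v(1) Suc by (simp add: lim_map_def d_d sections_closed)
  qed
next
  case 0
  have CQ: "C \<subseteq> Q" using C by blast
  have "\<exists>y. y \<in> carrier (ob F p) \<and> \<epsilon> p y = u p" if "p \<in> C" for p
  proof -
    have "u p \<in> \<epsilon> p ` carrier (ob F p)"
      using that CQ u 0 by (subst \<epsilon>_exact) (auto simp: sections_closed)
    then show ?thesis by auto
  qed
  then obtain y0 where y0: "\<And>p. p \<in> C \<Longrightarrow> y0 p \<in> carrier (ob F p) \<and> \<epsilon> p (y0 p) = u p"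
    by metis
  \<comment> \<open>Elements of the limit over \<open>C\<close> are extensional functions, hence the
    restriction.\<close>
  define y where "y = restrict y0 C"
  have y: "y p \<in> carrier (ob F p)" "\<epsilon> p (y p) = u p" if "p \<in> C" for p
    using y0 that by (simp_all add: y_def)
  \<comment> \<open>Compatibility is known for \<open>u\<close> in \<open>I 0\<close> and is pulled
    back along the injective \<open>\<epsilon>\<close>.\<close>
  have "res F q p (y q) = y p" if "p \<in> C" "q \<in> C" "p \<le> q" for p q
  proof (rule inj_onD[OF \<epsilon>_inj])
    show "p \<in> Q" using that CQ by blast
    show "\<epsilon> p (res F q p (y q)) = \<epsilon> p (y p)"
      using that CQ y sections_res[of u 0 p q] u(1) 0 by (simp add: \<epsilon>_res subsetD)
    show "res F q p (y q) \<in> carrier (ob F p)" "y p \<in> carrier (ob F p)"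
      using that CQ y by (auto intro: res_F_closed)
  qed
  then have "y \<in> carrier (lim_module C F)"
    using y by (simp add: mem_lim_module y_def)
  then obtain z where z: "z \<in> carrier (ob F h)" "y = to_lim C F h z"
    using onto 0 by (auto simp: restriction_onto_def)
  \<comment> \<open>The image of the lift \<open>z\<close> in \<open>I 0\<close>, spread over the
    ideal of \<open>h\<close>; at each point it lies in the image of \<open>\<epsilon>\<close>, so
    it is a cocycle.\<close>
  define w where "w = (\<lambda>p. res (I 0) h p (\<epsilon> h z))"
  have \<epsilon>z: "\<epsilon> h z \<in> carrier (ob (I 0) h)" using h z by (simp add: \<epsilon>_closed)
  have w_closed: "w p \<in> carrier (ob (I k) p)" if "p \<in> {p \<in> Q. p \<le> h}" for p
    using that h \<epsilon>z 0 by (simp add: w_def res_I_closed)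
  have w_res: "res (I k) q p (w q) = w p"
    if "p \<in> {p \<in> Q. p \<le> h}" "q \<in> {p \<in> Q. p \<le> h}" "p \<le> q" for p q
    using that h \<epsilon>z 0 by (simp add: w_def res_I_res)
  have w_\<epsilon>: "w p = \<epsilon> p (res F h p z)" if "p \<in> Q" "p \<le> h" for p
    using that h z by (simp add: w_def \<epsilon>_res)
  obtain w' where w': "w' \<in> sections k" "\<And>p. p \<in> {p \<in> Q. p \<le> h} \<Longrightarrow> w' p = w p"
    using extend_section[OF down_closed_in_principal w_closed w_res] by blast
  show thesis
  proof (rule that)
    show "w' \<in> sections k" by fact
    show "w' p = u p" if "p \<in> C" for p
    proof -
      have "res F h p z = y p" using z(2) that by (simp add: to_lim_def)
      then show ?thesis using that C y(2) w_\<epsilon> w'(2) by auto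
    qed
    show "d k p (w' p) = \<zero>\<^bsub>ob (I (Suc k)) p\<^esub>" if "p \<in> Q" "p \<le> h" for p
      using that h z w' w_\<epsilon> 0 by (simp add: d_\<epsilon> res_F_closed)
  qed
qed

text \<open>An element at \<open>h\<close> restricts to the whole ideal of \<open>h\<close>, so
  exactness at \<open>h\<close> alone gives a primitive \<open>u\<close> there. On \<open>C\<close>,
  where \<open>s\<close> vanishes, \<open>u\<close> is a cocycle. Subtracting a cocycle
  \<open>w\<close> on the ideal that agrees with \<open>u\<close> on \<open>C\<close> makes the
  primitive vanish on \<open>C\<close> and keeps its differential.\<close>

lemma relative_primitive:
  assumes h: "h \<in> Q" and C: "C \<subseteq> {p \<in> Q. p \<le> h}"
    and onto: "restriction_onto k h C"
    and s: "s \<in> sections (Suc k)" "d (Suc k) h (s h) = \<zero>\<^bsub>ob (I (Suc (Suc k))) h\<^esub>"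
      "\<And>p. p \<in> C \<Longrightarrow> s p = \<zero>\<^bsub>ob (I (Suc k)) p\<^esub>"
  obtains t where "t \<in> sections k" "\<And>p. p \<in> C \<Longrightarrow> t p = \<zero>\<^bsub>ob (I k) p\<^esub>"
    "\<And>p. \<lbrakk>p \<in> Q; p \<le> h\<rbrakk> \<Longrightarrow> d k p (t p) = s p"
proof -
  have "s h \<in> d k h ` carrier (ob (I k) h)"
    using h s by (subst d_exact) (auto simp: sections_closed)
  then obtain x where x: "x \<in> carrier (ob (I k) h)" "d k h x = s h" by auto
  have closed: "res (I k) h p x \<in> carrier (ob (I k) p)" if "p \<in> {p \<in> Q. p \<le> h}" for p
    using that h x by (simp add: res_I_closed)
  have compat: "res (I k) q p (res (I k) h q x) = res (I k) h p x"
    if "p \<in> {p \<in> Q. p \<le> h}" "q \<in> {p \<in> Q. p \<le> h}" "p \<le> q" for p q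
    using that h x by (simp add: res_I_res)
  obtain u where u: "u \<in> sections k" "\<And>p. p \<in> {p \<in> Q. p \<le> h} \<Longrightarrow> u p = res (I k) h p x"
    using extend_section[OF down_closed_in_principal closed compat] by blast
  have du: "d k p (u p) = s p" if "p \<in> Q" "p \<le> h" for p
    using that u h x s(1) by (simp add: d_res sections_res)
  then have "d k p (u p) = \<zero>\<^bsub>ob (I (Suc k)) p\<^esub>" if "p \<in> C" for p
    using that C s(3) by auto
  then obtain w where w: "w \<in> sections k" "\<And>p. p \<in> C \<Longrightarrow> w p = u p"
    "\<And>p. \<lbrakk>p \<in> Q; p \<le> h\<rbrakk> \<Longrightarrow> d k p (w p) = \<zero>\<^bsub>ob (I (Suc k)) p\<^esub>"
    using cocycle_extends[OF h C onto u(1)] by metis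
  show thesis
  proof (rule that)
    show "(\<lambda>p\<in>Q. u p \<ominus>\<^bsub>ob (I k) p\<^esub> w p) \<in> sections k"
      by (rule lim_module_minus_closed[OF I_presheaf u(1) w(1)])
    show "(\<lambda>p\<in>Q. u p \<ominus>\<^bsub>ob (I k) p\<^esub> w p) p = \<zero>\<^bsub>ob (I k) p\<^esub>" if "p \<in> C" for p
    proof -
      have p: "p \<in> Q" using that C by blast
      interpret M: module R "ob (I k) p" using p by (rule I_module)
      show ?thesis
        using that p w(2) sections_closed[OF u(1) p] by (simp add: a_minus_def M.r_neg)
    qed
    show "d k p ((\<lambda>p\<in>Q. u p \<ominus>\<^bsub>ob (I k) p\<^esub> w p) p) = s p" if "p \<in> Q" "p \<le> h" for p
    proof -
      interpret M: module R "ob (I (Suc k)) p" using that(1) by (rule I_module)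
      have "d k p (u p \<ominus>\<^bsub>ob (I k) p\<^esub> w p) = s p \<ominus>\<^bsub>ob (I (Suc k)) p\<^esub> \<zero>\<^bsub>ob (I (Suc k)) p\<^esub>"
        using d_minus[OF that(1) sections_closed[OF u(1) that(1)] sections_closed[OF w(1) that(1)]]
          du[OF that] w(3)[OF that] by simp
      then show ?thesis
        using that(1) sections_closed[OF s(1) that(1)] by (simp add: a_minus_def)
    qed
  qed
qed

text \<open>The set in the last hypothesis is the part of the ideal of \<open>h\<close> on which the
  earlier choices already prescribe the primitive.\<close>

lemma exact_on_union:
  assumes S: "S \<subseteq> Q" and wf: "wf r"
    and total: "\<And>g h. \<lbrakk>g \<in> S; h \<in> S; g \<noteq> h\<rbrakk> \<Longrightarrow> (g, h) \<in> r \<or> (h, g) \<in> r"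
    and onto: "\<And>h. h \<in> S \<Longrightarrow>
      restriction_onto k h {p \<in> Q. p \<le> h \<and> (\<exists>g\<in>S. (g, h) \<in> r \<and> p \<le> g)}"
  shows "exact_on k {p \<in> Q. \<exists>g\<in>S. p \<le> g}"
  unfolding exact_on_def
proof (intro ballI impI)
  fix s assume s: "s \<in> sections (Suc k)"
    and ds: "\<forall>p\<in>{p \<in> Q. \<exists>g\<in>S. p \<le> g}. d (Suc k) p (s p) = \<zero>\<^bsub>ob (I (Suc (Suc k))) p\<^esub>"
  \<comment> \<open>\<open>P f h t\<close> says that \<open>t\<close> is an admissible choice at
    \<open>h\<close> after the earlier choices \<open>f\<close>. It consults \<open>f\<close> only
    at predecessors of \<open>h\<close>, as dependent choice along a well-founded relation requires,
    and is void outside \<open>S\<close>.\<close>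
  define P where "P f h t \<longleftrightarrow> (h \<in> S \<longrightarrow> t \<in> sections k \<and>
      (\<forall>p\<in>Q. p \<le> h \<longrightarrow> d k p (t p) = s p) \<and>
      (\<forall>g\<in>S. (g, h) \<in> r \<longrightarrow> (\<forall>p\<in>Q. p \<le> g \<and> p \<le> h \<longrightarrow> f g p = t p)))" for f h t
  have "\<exists>f. \<forall>h. P f h (f h)"
  proof (rule dependent_wf_choice[OF wf])
    show "P f h t = P g h t" if "\<And>z. (z, h) \<in> r \<Longrightarrow> f z = g z" for f g h t
      using that by (auto simp: P_def)
    fix h f assume IH: "\<And>g. (g, h) \<in> r \<Longrightarrow> P f g (f g)"
    show "\<exists>t. P f h t"
    proof (cases "h \<in> S")
      case False
      then show ?thesis by (simp add: P_def)
    next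
      case True
      then have h: "h \<in> Q" using S by blast
      let ?T = "{g \<in> S. (g, h) \<in> r}"
      let ?C = "{p \<in> Q. p \<le> h \<and> (\<exists>g\<in>S. (g, h) \<in> r \<and> p \<le> g)}"
      have f: "f g \<in> sections k" if "g \<in> ?T" for g
        using IH[of g] that by (simp add: P_def)
      have df: "d k p (f g p) = s p" if "g \<in> ?T" "p \<in> Q" "p \<le> g" for g p
        using IH[of g] that by (simp add: P_def)
      \<comment> \<open>Of two distinct elements one precedes the other, and the later choice was
        made to agree with the earlier one.\<close>
      have agree: "f g p = f g' p" if "g \<in> ?T" "g' \<in> ?T" "p \<in> Q" "p \<le> g" "p \<le> g'" for g g' p
        using total[of g g'] IH[of g] IH[of g'] that by (cases "g = g'") (auto simp: P_def)
      obtain t where t: "t \<in> sections k" "\<And>g p. \<lbrakk>g \<in> ?T; p \<in> Q; p \<le> g\<rbrakk> \<Longrightarrow> t p = f g p"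
        using glue_sections[of ?T f, OF f agree] by blast
      \<comment> \<open>The defect of \<open>t\<close>. It vanishes on \<open>?C\<close>, where
        \<open>t\<close> is already a primitive of \<open>s\<close>, so a relative primitive of it
        corrects \<open>t\<close> over the ideal of \<open>h\<close> without changing the prescribed
        values.\<close>
      define s' where "s' = (\<lambda>p\<in>Q. s p \<ominus>\<^bsub>ob (I (Suc k)) p\<^esub> d k p (t p))"
      \<comment> \<open>Written with \<open>lim_map\<close>, the defect is visibly a difference of
        sections.\<close>
      have "s' = (\<lambda>p\<in>Q. s p \<ominus>\<^bsub>ob (I (Suc k)) p\<^esub> lim_map Q (d k) t p)"
        by (simp add: s'_def lim_map_def fun_eq_iff restrict_def)
      then have s': "s' \<in> sections (Suc k)"
        using lim_module_minus_closed[OF I_presheaf s lim_map_closed[OF d_nat t(1)]] by simp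
      have ds': "d (Suc k) h (s' h) = \<zero>\<^bsub>ob (I (Suc (Suc k))) h\<^esub>"
      proof -
        interpret M: module R "ob (I (Suc (Suc k))) h" using h by (rule I_module)
        have "d (Suc k) h (s h) = \<zero>\<^bsub>ob (I (Suc (Suc k))) h\<^esub>" using ds h True by blast
        then have "d (Suc k) h (s h \<ominus>\<^bsub>ob (I (Suc k)) h\<^esub> d k h (t h)) =
            \<zero>\<^bsub>ob (I (Suc (Suc k))) h\<^esub> \<ominus>\<^bsub>ob (I (Suc (Suc k))) h\<^esub> \<zero>\<^bsub>ob (I (Suc (Suc k))) h\<^esub>"
          using h s t(1) by (simp add: d_minus sections_closed d_closed d_d)
        then show ?thesis using h by (simp add: s'_def a_minus_def)
      qed
      have s'0: "s' p = \<zero>\<^bsub>ob (I (Suc k)) p\<^esub>" if p: "p \<in> ?C" for p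
      proof -
        have pQ: "p \<in> Q" using p by simp
        interpret M: module R "ob (I (Suc k)) p" using pQ by (rule I_module)
        have "d k p (t p) = s p" using p t(2) df by auto
        then show ?thesis
          using pQ sections_closed[OF s pQ] by (simp add: s'_def a_minus_def M.r_neg)
      qed
      obtain u where u: "u \<in> sections k" "\<And>p. p \<in> ?C \<Longrightarrow> u p = \<zero>\<^bsub>ob (I k) p\<^esub>"
        "\<And>p. \<lbrakk>p \<in> Q; p \<le> h\<rbrakk> \<Longrightarrow> d k p (u p) = s' p"
        using relative_primitive[OF h _ onto[OF True] s' ds' s'0] by auto
      let ?t = "\<lambda>p\<in>Q. t p \<oplus>\<^bsub>ob (I k) p\<^esub> u p"
      have "?t \<in> sections k"
        by (rule lim_module_add_closed[OF I_presheaf t(1) u(1)])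
      moreover have "d k p (?t p) = s p" if "p \<in> Q" "p \<le> h" for p
      proof -
        interpret M: module R "ob (I (Suc k)) p" using that(1) by (rule I_module)
        have "d k p (t p) \<in> carrier (ob (I (Suc k)) p)" "s p \<in> carrier (ob (I (Suc k)) p)"
          using that s t(1) by (simp_all add: d_closed sections_closed)
        then show ?thesis
          using that t(1) u(1,3)
          by (simp add: d_add sections_closed s'_def a_minus_def M.a_lcomm M.r_neg)
      qed
      moreover have "f g p = ?t p" if "g \<in> S" "(g, h) \<in> r" "p \<in> Q" "p \<le> g" "p \<le> h" for g p
      proof -
        interpret M: module R "ob (I k) p" using that(3) by (rule I_module)
        have "u p = \<zero>\<^bsub>ob (I k) p\<^esub>" using that u(2) by blast
        moreover have "t p = f g p" using that t(2) by simp
        ultimately show ?thesis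
          using that sections_closed[OF t(1) that(3)] by simp
      qed
      ultimately have "P f h ?t" by (simp add: P_def)
      then show ?thesis by blast
    qed
  qed
  then obtain f where "\<And>h. P f h (f h)" by blast
  then have P: "P f h (f h)" for h by blast
  have f: "f h \<in> sections k" if "h \<in> S" for h
    using P[of h] that by (simp add: P_def)
  have df: "d k p (f h p) = s p" if "h \<in> S" "p \<in> Q" "p \<le> h" for h p
    using P[of h] that by (simp add: P_def)
  have agree: "f g p = f h p" if "g \<in> S" "h \<in> S" "p \<in> Q" "p \<le> g" "p \<le> h" for g h p
    using total[of g h] P[of g] P[of h] that by (cases "g = h") (auto simp: P_def)
  obtain t where t: "t \<in> sections k" "\<And>g p. \<lbrakk>g \<in> S; p \<in> Q; p \<le> g\<rbrakk> \<Longrightarrow> t p = f g p"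
    using glue_sections[of S f, OF f agree] by blast
  show "\<exists>t\<in>sections k. \<forall>p\<in>{p \<in> Q. \<exists>g\<in>S. p \<le> g}. d k p (t p) = s p"
  proof (intro bexI[OF _ t(1)] ballI)
    fix p assume "p \<in> {p \<in> Q. \<exists>g\<in>S. p \<le> g}"
    then obtain g where "g \<in> S" "p \<in> Q" "p \<le> g" by blast
    then show "d k p (t p) = s p" using t(2) df by simp
  qed
qed

text \<open>Exactness makes cocycles and coboundaries the same set \<open>N\<close>, so the quotient
  consists of the cosets of \<open>N\<close> in itself.\<close>

lemma higher_limit_zero:
  assumes "exact_on k Q"
  shows "zero_module (higher_limit Q I d (Suc k))"
proof -
  let ?M = "lim_module Q (I (Suc k))"
  define N where "N = lim_map Q (d k) ` sections k"
  have N: "N \<subseteq> sections (Suc k)"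
    unfolding N_def using lim_map_closed[OF d_nat] by blast
  have "cocycles (\<lambda>k. lim_module Q (I k)) (\<lambda>k. lim_map Q (d k)) (Suc k) = N"
  proof (intro equalityI subsetI)
    fix s assume "s \<in> cocycles (\<lambda>k. lim_module Q (I k)) (\<lambda>k. lim_map Q (d k)) (Suc k)"
    then have s: "s \<in> sections (Suc k)"
      and "lim_map Q (d (Suc k)) s = (\<lambda>p\<in>Q. \<zero>\<^bsub>ob (I (Suc (Suc k))) p\<^esub>)"
      by (simp_all add: cocycles_def mem_a_kernel) (simp add: lim_module_def)
    then have "d (Suc k) p (s p) = \<zero>\<^bsub>ob (I (Suc (Suc k))) p\<^esub>" if "p \<in> Q" for p
      using that by (auto simp: lim_map_def dest: fun_cong[of _ _ p])
    then obtain t where "t \<in> sections k" "\<forall>p\<in>Q. d k p (t p) = s p"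
      using assms s by (auto simp: exact_on_def)
    moreover from this have "s = lim_map Q (d k) t"
      using s by (auto simp: lim_map_def mem_lim_module intro!: extensionalityI[of _ Q])
    ultimately show "s \<in> N" unfolding N_def by blast
  next
    fix s assume "s \<in> N"
    then obtain t where t: "t \<in> sections k" and s: "s = lim_map Q (d k) t" unfolding N_def by blast
    have "lim_map Q (d (Suc k)) s = (\<lambda>p\<in>Q. \<zero>\<^bsub>ob (I (Suc (Suc k))) p\<^esub>)"
      using t by (auto simp: s lim_map_def d_d sections_closed)
    then show "s \<in> cocycles (\<lambda>k. lim_module Q (I k)) (\<lambda>k. lim_map Q (d k)) (Suc k)"
      using N \<open>s \<in> N\<close> by (auto simp: cocycles_def mem_a_kernel) (simp add: lim_module_def)
  qed
  then have H: "higher_limit Q I d (Suc k) = quotient_module (?M\<lparr>carrier := N\<rparr>) N"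
    by (simp add: higher_limit_def cohomology_def N_def)
  \<comment> \<open>Translation by an element of \<open>N\<close> is a bijection of
    \<open>N\<close>: sums and differences of primitives are primitives of sums and
    differences.\<close>
  have coset: "(\<lambda>n. n \<oplus>\<^bsub>?M\<^esub> a) ` N = N" if a: "a \<in> N" for a
  proof (intro equalityI subsetI)
    obtain a' where a': "a' \<in> sections k" "a = lim_map Q (d k) a'" using a unfolding N_def by blast
    fix m assume "m \<in> (\<lambda>n. n \<oplus>\<^bsub>?M\<^esub> a) ` N"
    then obtain n' where n': "n' \<in> sections k" "m = lim_map Q (d k) n' \<oplus>\<^bsub>?M\<^esub> a"
      unfolding N_def by blast
    have "m = lim_map Q (d k) (\<lambda>p\<in>Q. n' p \<oplus>\<^bsub>ob (I k) p\<^esub> a' p)"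
      using a' n' by (auto simp: lim_map_def lim_module_def[of Q "I (Suc k)"] d_add sections_closed)
    then show "m \<in> N"
      unfolding N_def using lim_module_add_closed[OF I_presheaf n'(1) a'(1)] by blast
  next
    obtain a' where a': "a' \<in> sections k" "a = lim_map Q (d k) a'" using a unfolding N_def by blast
    fix m assume "m \<in> N"
    then obtain m' where m': "m' \<in> sections k" "m = lim_map Q (d k) m'" unfolding N_def by blast
    let ?n = "lim_map Q (d k) (\<lambda>p\<in>Q. m' p \<ominus>\<^bsub>ob (I k) p\<^esub> a' p)"
    have "d k p (m' p \<ominus>\<^bsub>ob (I k) p\<^esub> a' p) \<oplus>\<^bsub>ob (I (Suc k)) p\<^esub> d k p (a' p) = d k p (m' p)"
      if "p \<in> Q" for p
    proof -
      interpret M: module R "ob (I (Suc k)) p" using that by (rule I_module)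
      have "d k p (m' p) \<in> carrier (ob (I (Suc k)) p)" "d k p (a' p) \<in> carrier (ob (I (Suc k)) p)"
        using that m'(1) a'(1) by (simp_all add: d_closed sections_closed)
      moreover have "d k p (m' p \<ominus>\<^bsub>ob (I k) p\<^esub> a' p) = d k p (m' p) \<ominus>\<^bsub>ob (I (Suc k)) p\<^esub> d k p (a' p)"
        using that m'(1) a'(1) by (simp add: d_minus sections_closed)
      ultimately show ?thesis by (simp add: a_minus_def M.a_assoc M.l_neg)
    qed
    then have "m = ?n \<oplus>\<^bsub>?M\<^esub> a"
      using a' m' by (auto simp: lim_map_def lim_module_def[of Q "I (Suc k)"])
    then show "m \<in> (\<lambda>n. n \<oplus>\<^bsub>?M\<^esub> a) ` N"
      unfolding N_def using lim_module_minus_closed[OF I_presheaf m'(1) a'(1)] by blast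
  qed
  \<comment> \<open>An empty \<open>N\<close> would have no coset at all; extending the empty family
    yields a section.\<close>
  have "N \<noteq> {}"
  proof -
    have "down_closed_in Q {}" by (simp add: down_closed_in_def)
    then obtain t where "t \<in> sections k" using extend_section[of "{}"] by blast
    then show ?thesis unfolding N_def by blast
  qed
  then have "a_rcosets\<^bsub>?M\<lparr>carrier := N\<rparr>\<^esub> N = {N}"
    by (simp add: A_RCOSETS_def RCOSETS_def r_coset_def UNION_singleton_eq_range coset
        cong: image_cong)
  then show ?thesis
    by (simp add: H zero_module_def quotient_module_def)
qed

end

section \<open>Initial segments of coatoms\<close>

text \<open>Degrees below the maximum are bounded by its degree, so some element above
  \<open>p\<close> has the largest one. As \<open>deg\<close> is strictly monotone, nothing lies
  between that element and the maximum.\<close>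

lemma filtered_coatom_above:
  fixes p :: "'p::order_top"
  assumes "filtered TYPE('p)" "p < Orderings.top"
  obtains q where "p \<le> q" "q \<prec> Orderings.top"
proof -
  have mono: "strict_mono (deg :: 'p \<Rightarrow> nat)" using assms(1) by (simp add: filtered_def)
  have "\<exists>q. (p \<le> q \<and> q < Orderings.top) \<and>
      (\<forall>y. p \<le> y \<and> y < Orderings.top \<longrightarrow> deg y \<le> deg q)"
  proof (rule ex_has_greatest_nat)
    show "p \<le> p \<and> p < Orderings.top" using assms(2) by simp
    show "\<forall>y. p \<le> y \<and> y < Orderings.top \<longrightarrow> deg y < deg (Orderings.top :: 'p)"
      using mono by (auto simp: strict_mono_def)
  qed
  then obtain q where q: "p \<le> q" "q < Orderings.top"
    "\<And>y. \<lbrakk>p \<le> y; y < Orderings.top\<rbrakk> \<Longrightarrow> deg y \<le> deg q" by blast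
  have "\<not> (q < y \<and> y < Orderings.top)" for y
    using q(1) q(3)[of y] strict_monoD[OF mono, of q y] by (auto simp: order.trans less_imp_le)
  then show thesis using that q(1,2) unfolding covered_by_def by blast
qed

text \<open>The inclusion from left to right is (CL2). For the converse, the coatom \<open>g\<close>
  witnessing membership in \<open>C_set L (h # c)\<close> precedes \<open>h\<close>, hence lies in
  the initial segment \<open>S\<close>.\<close>

lemma preceding_ideals_inter:
  fixes L :: "'p::{order_bot,order_top} list \<Rightarrow> 'p rel"
  assumes L: "dual_CL_shellable L" and c: "top_chain c"
    and S: "Order_Relation.ofilter (L c) S" and h: "h \<in> S"
  shows "{p. p \<le> h \<and> (\<exists>g\<in>S. (g, h) \<in> L c - Id \<and> p \<le> g)} = down_closure (C_set L (h # c))"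
proof -
  have wo: "well_order_on {q. q \<prec> hd c} (L c)"
    using L c by (simp add: dual_CL_shellable_def coatom_ordering_def)
  then have S_coatoms: "g \<prec> hd c" if "g \<in> S" for g
    using that S well_order_on_Field[OF wo] by (auto simp: Order_Relation.ofilter_def)
  have "c \<noteq> []" using c by (simp add: top_chain_def)
  then have C: "C_set L (h # c) =
      {x. x \<prec> h \<and> (\<exists>g. g \<prec> hd c \<and> strictly_precedes (L c) g h \<and> x < g)}"
    by (cases c) simp_all
  have CL2: "CL2 L c" using L c by (simp add: dual_CL_shellable_def)
  show ?thesis
  proof (intro equalityI subsetI)
    fix p assume "p \<in> {p. p \<le> h \<and> (\<exists>g\<in>S. (g, h) \<in> L c - Id \<and> p \<le> g)}"
    then obtain g where g: "p \<le> h" "g \<in> S" "(g, h) \<in> L c" "g \<noteq> h" "p \<le> g" by blast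
    have gc: "g \<prec> hd c" "h \<prec> hd c" using S_coatoms g h by auto
    \<comment> \<open>Distinct elements covered by the same element are incomparable, so
      \<open>p\<close> is neither of them; (CL2) asks for strict inequalities.\<close>
    then have "\<not> h < g" "\<not> g < h" by (auto simp: covered_by_def)
    then have "p < h" "p < g" using g by (auto simp: order.order_iff_strict)
    then obtain h'' q where "h'' \<prec> hd c" "strictly_precedes (L c) h'' h" "q \<prec> h" "p \<le> q" "q < h''"
      using CL2 g gc unfolding CL2_def strictly_precedes_def by blast
    then show "p \<in> down_closure (C_set L (h # c))"
      unfolding C down_closure_def by blast
  next
    fix p assume "p \<in> down_closure (C_set L (h # c))"
    then obtain x g where x: "p \<le> x" "x \<prec> h" "strictly_precedes (L c) g h" "x < g"
      unfolding C down_closure_def by blast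
    have "g \<in> S"
      using x(3) S h by (auto simp: strictly_precedes_def Order_Relation.ofilter_def
          Order_Relation.under_def)
    moreover have "p \<le> h" "p \<le> g"
      using x by (auto simp: covered_by_def intro: order_trans less_imp_le)
    ultimately show "p \<in> {p. p \<le> h \<and> (\<exists>g\<in>S. (g, h) \<in> L c - Id \<and> p \<le> g)}"
      using x(3) by (auto simp: strictly_precedes_def)
  qed
qed

theorem theorem1:
  fixes R :: "('r, 'k) ring_scheme"
    and L :: "'p::{order_bot,order_top} list \<Rightarrow> 'p rel"
    and F :: "('p, 'r, 'm) presheaf"
    and i :: nat
    and \<epsilon> :: "'p \<Rightarrow> 'm \<Rightarrow> 'u"
    and I :: "nat \<Rightarrow> ('p, 'r, 'u) presheaf"
    and d :: "nat \<Rightarrow> 'p \<Rightarrow> 'u \<Rightarrow> 'u"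
  assumes "cring R"
    and "dual_CL_shellable L"
    and "1 \<le> i" and "i \<le> poset_deg TYPE('p) - 1"
    and "presheaf_on R UNIV F"
    and "stable_at L F i"
    and "injective_resolution R (UNIV - {Orderings.top}) F \<epsilon> I d"
  shows "zero_module (higher_limit (UNIV - {Orderings.top}) I d i)"
proof -
  let ?Q = "UNIV - {Orderings.top} :: 'p set"
  have "presheaf_on R ?Q F"
    using assms(5) by (simp add: presheaf_on_def)
  then interpret presheaf_resolution R ?Q F \<epsilon> I d
    using assms(1,7) by (intro presheaf_resolution.intro)
  have wo: "well_order_on {q. q \<prec> hd c} (L c)" if "top_chain c" for c
    using that assms(2) by (simp add: dual_CL_shellable_def coatom_ordering_def)
  \<comment> \<open>Two shifts by one: \<open>exact_on k\<close> concerns degree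
    \<open>k + 1\<close>, and a list with \<open>i - k\<close> entries is a chain of length
    \<open>i - (k + 1)\<close>.\<close>
  have *: "exact_on k (down_closure S)"
    if "top_chain c" "length c + k = i" "Order_Relation.ofilter (L c) S" for k c S
    using that
  proof (induction k arbitrary: c S rule: less_induct)
    case (less k)
    have S_coatoms: "g \<prec> hd c" if "g \<in> S" for g
      using that less.prems(3) well_order_on_Field[OF wo[OF less.prems(1)]]
      by (auto simp: Order_Relation.ofilter_def)
    have not_top: "p \<noteq> Orderings.top" if "g \<in> S" "p \<le> g" for p g
    proof -
      have "g < hd c" using S_coatoms[OF that(1)] by (simp add: covered_by_def)
      then have "g < Orderings.top" using top_greatest by (rule order.strict_trans2)
      with that(2) have "p < Orderings.top" by (rule order.strict_trans1)
      then show ?thesis by simp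
    qed
    have "exact_on k {p \<in> ?Q. \<exists>g\<in>S. p \<le> g}"
    proof (rule exact_on_union)
      show "S \<subseteq> ?Q" using not_top by auto
      show "wf (L c - Id)"
        using wo[OF less.prems(1)] by (simp add: well_order_on_def)
      show "(g, h) \<in> L c - Id \<or> (h, g) \<in> L c - Id" if "g \<in> S" "h \<in> S" "g \<noteq> h" for g h
        using wo[OF less.prems(1)] S_coatoms that
        by (simp add: well_order_on_def linear_order_on_def total_on_def)
      fix h assume h: "h \<in> S"
      have hc: "top_chain (h # c)"
        using less.prems(1) S_coatoms[OF h] by (cases c) (auto simp: top_chain_def)
      have "restriction_onto k h (down_closure (C_set L (h # c)))"
      proof (cases k)
        case 0
        \<comment> \<open>With \<open>i + 1\<close> entries \<open>h # c\<close> is a chain of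
          length \<open>i\<close>, the length at which stability is assumed.\<close>
        then have "length (h # c) = i + 1" using less.prems(2) by simp
        then show ?thesis
          using assms(6)[unfolded stable_at_def, rule_format, of "h # c"] hc 0
          by (simp add: restriction_onto_def)
      next
        case (Suc j)
        \<comment> \<open>(CL1) makes \<open>C_set L (h # c)\<close> an initial segment for the
          longer chain, so the induction hypothesis applies to it one degree lower.\<close>
        have "CL1 L (h # c)" using assms(2) hc by (simp add: dual_CL_shellable_def)
        then show ?thesis
          using less.IH[of j "h # c"] hc less.prems(2) Suc
          by (simp add: restriction_onto_def CL1_def)
      qed
      \<comment> \<open>Elements below \<open>h\<close> are never the maximum, so the intersection
        computed in the whole poset can be used.\<close>
      moreover have "{p \<in> ?Q. p \<le> h \<and> (\<exists>g\<in>S. (g, h) \<in> L c - Id \<and> p \<le> g)} =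
          {p. p \<le> h \<and> (\<exists>g\<in>S. (g, h) \<in> L c - Id \<and> p \<le> g)}"
        using not_top[OF h] by blast
      ultimately show "restriction_onto k h
          {p \<in> ?Q. p \<le> h \<and> (\<exists>g\<in>S. (g, h) \<in> L c - Id \<and> p \<le> g)}"
        using preceding_ideals_inter[OF assms(2) less.prems(1,3) h] by simp
    qed
    moreover have "{p \<in> ?Q. \<exists>g\<in>S. p \<le> g} = down_closure S"
      using not_top unfolding down_closure_def by blast
    ultimately show ?case by simp
  qed
  have top: "top_chain [Orderings.top :: 'p]" by (simp add: top_chain_def)
  \<comment> \<open>The claim is applied to the chain of length 0 and the initial segment of all its
    coatoms, whose ideals cover everything but the maximum.\<close>
  have "Order_Relation.ofilter (L [Orderings.top]) {q. q \<prec> Orderings.top}"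
    using well_order_on_Field[OF wo[OF top]] wo[OF top]
    by (auto simp: Order_Relation.ofilter_def Order_Relation.under_def intro: FieldI1)
  then have "exact_on (i - 1) (down_closure {q. q \<prec> Orderings.top})"
    using *[OF top] assms(3) by simp
  moreover have "down_closure {q. q \<prec> Orderings.top} = ?Q"
  proof (intro equalityI subsetI)
    fix p :: 'p assume "p \<in> ?Q"
    then have "p < Orderings.top" by (simp add: top.not_eq_extremum)
    moreover have "filtered TYPE('p)" using assms(2) by (simp add: dual_CL_shellable_def)
    ultimately obtain q where "p \<le> q" "q \<prec> Orderings.top"
      using filtered_coatom_above[of p] by blast
    then show "p \<in> down_closure {q. q \<prec> Orderings.top}" by (auto simp: down_closure_def)
  next
    fix p :: 'p assume "p \<in> down_closure {q. q \<prec> Orderings.top}"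
    then obtain q where "p \<le> q" "q < Orderings.top"
      by (auto simp: down_closure_def covered_by_def)
    then show "p \<in> ?Q" by auto
  qed
  ultimately have "exact_on (i - 1) ?Q" by simp
  then show ?thesis
    using higher_limit_zero[of "i - 1"] assms(3) by simp
qed

end
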